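(* Let $X$ be a compact complex manifold of dimension $k$ and let $f:X\to X$ be a dominating meromorphic map. For $0\le m\le k-1$ and $0\le l\le m$, we have $$h^{top}_{(m+1,l)}(f)\geq h^{top}_{(m,l)}(f).$$
   Context: $I$ is the indeterminacy set of $f$, $d$ is a fixed distance on $X$ (compatible with the manifold structure), and a finite family of charts of $X$ is fixed. Balls and graphs. In a chart one uses the norm $\|x\|=\max(|x_1|,\dots,|x_k|)$. $B_l(x,r)$ denotes a ball of dimension $l$ with center $x$ and radius $r$: in a chart it is the ball of an (affine) complex plane $P$ of dimension $l$. A graph of a holomorphic map $\Phi$ over $B_l(x,r)$ is a set $\{(X',\Phi(X')): X'\in B_l(x,r)\}$ in a chart, written in orthonormal linear coordinates adapted to $P$ (first $l$ coordinates along $P$, the other $k-l$ along the orthogonal complement, $\Phi$ taking values in the latter), norms being max norms in these coordinates; $Lip(\Phi)$ is the Lipschitz constant. For $0\le l\le k$, $\delta>0$, $n\in\mathbb{N}$: - $X_l^{\delta,n}$ is the set of $W\subset X$ such that $W$ is a graph of a holomorphic map $\Phi$ over a ball $B_l(x,e^{-\delta n})$ with $Lip(\Phi)\le 1$ and $f^j(W)\subset X\setminus I$ for all $0\le j\le n-1$. - $X_l^{\delta}$ is the set of $W\subset X$ such that $W$ is a graph of a holomorphic map $\Phi$ over a ball $B_l(x,\delta)$ with $Lip(\Phi)\le1$ and $\Phi(x)=0$. Conventions: $B_0(x,r)=\{x\}$, $X_0^{\delta,n}=\{x\in X: f^j(x)\in X\setminus I \text{ for all } 0\le j\le n-1\}$,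 $X_0^\delta=X$, and a graph over $B_k(x,r)$ is $B_k(x,r)$ itself. For $A,B\subset X$, $d(A,B)=\inf\{d(x,y):x\in A,\ y\in B\}$. A set $E\subset X_l^{\delta,n}$ is $(n,\delta)$-separated if $\max_{0\le i\le n-1} d(f^i(W),f^i(W'))\ge\delta$ for all $W\ne W'$ in $E$. For $0\le l\le m\le k$ the $(m,l)$-topological entropy is $$h^{top}_{(m,l)}(f)=\limsup_{\delta\to0}\ \limsup_{n\to\infty}\frac1n\log\sup_{\Delta\in X_m^\delta}\max\{\#E:\ E\subset X_l^{\delta,n}\ (n,\delta)\text{-separated},\ W\subset f^{-n}(\Delta)\ \text{for all } W\in E\}.$$ For $W\in X_l^{\delta,n}$, $W\subset f^{-n}(\Delta)$ means $f^n(W)\subset\Delta$. *)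

theory Defs
  imports "HOL-Analysis.Analysis"
begin

section \<open>Holomorphic functions of several variables\<close>

text \<open>
  \<open>S\<close> is either open or a relatively open piece of a coordinate subspace of
  \<open>\<complex>\<^sup>n\<close>. In the second case the derivative within \<open>S\<close> is only determined along the
  subspace, and the existence of a complex linear one says that \<open>g\<close> is holomorphic
  in the variables of that subspace.
\<close>

definition holomorphic_fun :: "(complex ^ 'n \<Rightarrow> complex) \<Rightarrow> (complex ^ 'n) set \<Rightarrow> bool" where
  "holomorphic_fun g S \<longleftrightarrow>
     (\<forall>x\<in>S. \<exists>L. (g has_derivative L) (at x within S) \<and> (\<forall>c v. L (c *s v) = c * L v))"

definition holomorphic_vec :: "(complex ^ 'n \<Rightarrow> complex ^ 'm) \<Rightarrow> (complex ^ 'n) set \<Rightarrow> bool" where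
  "holomorphic_vec F S \<longleftrightarrow> (\<forall>i. holomorphic_fun (\<lambda>x. F x $ i) S)"


section \<open>Complex manifolds\<close>

text \<open>
  The manifold is the whole type \<open>'a\<close>, its dimension is \<open>CARD('n)\<close>, and its complex
  structure is given by an atlas. A chart is a pair of its domain and its coordinate map.
\<close>

type_synonym ('a, 'n) chart = "'a set \<times> ('a \<Rightarrow> complex ^ 'n)"

definition topological_chart :: "('a::topological_space, 'n::finite) chart \<Rightarrow> bool" where
  "topological_chart c \<longleftrightarrow>
     (case c of (U, \<phi>) \<Rightarrow> open U \<and> open (\<phi> ` U) \<and> (\<exists>\<psi>. homeomorphism U (\<phi> ` U) \<phi> \<psi>))"

definition compatible_charts ::
  "('a::topological_space, 'n::finite) chart \<Rightarrow> ('a, 'n) chart \<Rightarrow> bool" where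
  "compatible_charts c c' \<longleftrightarrow>
     (case c of (U, \<phi>) \<Rightarrow> case c' of (U', \<phi>') \<Rightarrow>
        holomorphic_vec (\<phi>' \<circ> inv_into U \<phi>) (\<phi> ` (U \<inter> U')) \<and>
        holomorphic_vec (\<phi> \<circ> inv_into U' \<phi>') (\<phi>' ` (U \<inter> U')))"

definition complex_atlas :: "('a::topological_space, 'n::finite) chart set \<Rightarrow> bool" where
  "complex_atlas A \<longleftrightarrow>
     (\<Union>c\<in>A. fst c) = UNIV \<and>
     (\<forall>c\<in>A. topological_chart c) \<and>
     (\<forall>c\<in>A. \<forall>c'\<in>A. compatible_charts c c')"

definition compact_complex_manifold :: "('a::t2_space, 'n::finite) chart set \<Rightarrow> bool" where
  "compact_complex_manifold A \<longleftrightarrow> compact (UNIV :: 'a set) \<and> complex_atlas A"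

definition holomorphic_charts ::
  "('a::topological_space, 'n::finite) chart set \<Rightarrow> ('a, 'n) chart set" where
  "holomorphic_charts A = {c. topological_chart c \<and> (\<forall>c'\<in>A. compatible_charts c c')}"

definition product_chart ::
  "('a, 'n::finite) chart \<Rightarrow> ('b, 'm::finite) chart \<Rightarrow> ('a \<times> 'b, 'n + 'm) chart" where
  "product_chart c c' =
     (fst c \<times> fst c',
      \<lambda>p. \<chi> s. case s of Inl i \<Rightarrow> snd c (fst p) $ i | Inr j \<Rightarrow> snd c' (snd p) $ j)"

definition product_atlas ::
  "('a, 'n::finite) chart set \<Rightarrow> ('b, 'm::finite) chart set \<Rightarrow> ('a \<times> 'b, 'n + 'm) chart set" where
  "product_atlas A B = {product_chart c c' | c c'. c \<in> A \<and> c' \<in> B}"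

definition holomorphic_on_manifold ::
  "('a::topological_space, 'n::finite) chart set \<Rightarrow> ('a \<Rightarrow> complex) \<Rightarrow> 'a set \<Rightarrow> bool" where
  "holomorphic_on_manifold A g N \<longleftrightarrow>
     (\<forall>(U, \<phi>)\<in>A. holomorphic_fun (g \<circ> inv_into U \<phi>) (\<phi> ` (U \<inter> N)))"

definition holomorphic_map ::
  "('a::topological_space, 'n::finite) chart set \<Rightarrow> ('b::topological_space, 'm::finite) chart set \<Rightarrow>
   ('a \<Rightarrow> 'b) \<Rightarrow> 'a set \<Rightarrow> bool" where
  "holomorphic_map A B g N \<longleftrightarrow>
     continuous_on N g \<and>
     (\<forall>(U, \<phi>)\<in>A. \<forall>(V, \<psi>)\<in>B.
        holomorphic_vec (\<psi> \<circ> g \<circ> inv_into U \<phi>) (\<phi> ` (U \<inter> N \<inter> g -` V)))"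

definition analytic_subset ::
  "('a::topological_space, 'n::finite) chart set \<Rightarrow> 'a set \<Rightarrow> bool" where
  "analytic_subset A Z \<longleftrightarrow>
     (\<forall>p. \<exists>N G. open N \<and> p \<in> N \<and> finite G \<and>
        (\<forall>g\<in>G. holomorphic_on_manifold A g N) \<and>
        Z \<inter> N = {q \<in> N. \<forall>g\<in>G. g q = 0})"


section \<open>Meromorphic maps\<close>

text \<open>
  A meromorphic map is identified with its graph \<open>\<Gamma>\<close>: an analytic subset of \<open>X \<times> X\<close>
  which is the closure of the graph of a holomorphic map defined off a nowhere dense
  analytic subset of \<open>X\<close>. (When \<open>X\<close> is connected, \<open>\<Gamma>\<close> is then irreducible.)
\<close>

definition meromorphic_map ::
  "('a::topological_space, 'n::finite) chart set \<Rightarrow> ('a \<times> 'a) set \<Rightarrow> bool" where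
  "meromorphic_map A \<Gamma> \<longleftrightarrow>
     analytic_subset (product_atlas A A) \<Gamma> \<and>
     (\<exists>Z g. analytic_subset A Z \<and> interior Z = {} \<and> holomorphic_map A A g (- Z) \<and>
        \<Gamma> = closure {(x, g x) | x. x \<notin> Z})"

definition dominating :: "('a \<times> 'a) set \<Rightarrow> bool" where
  "dominating \<Gamma> \<longleftrightarrow> snd ` \<Gamma> = UNIV"

text \<open>The set of points near which \<open>\<Gamma>\<close> is not the graph of a holomorphic map.\<close>

definition indeterminacy_set ::
  "('a::topological_space, 'n::finite) chart set \<Rightarrow> ('a \<times> 'a) set \<Rightarrow> 'a set" where
  "indeterminacy_set A \<Gamma> =
     {x. \<not> (\<exists>N g. open N \<and> x \<in> N \<and> holomorphic_map A A g N \<and>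
              \<Gamma> \<inter> (N \<times> UNIV) = {(y, g y) | y. y \<in> N})}"

text \<open>Meaningful off the indeterminacy set only.\<close>

definition mero_fun :: "('a \<times> 'a) set \<Rightarrow> 'a \<Rightarrow> 'a" where
  "mero_fun \<Gamma> x = (THE y. (x, y) \<in> \<Gamma>)"


section \<open>Graphs over balls of complex planes in charts\<close>

text \<open>
  The fixed finite family of charts. As usual, each chart \<open>\<phi>\<close> is taken to be defined on a
  neighbourhood \<open>U\<close> of the closure of the open set \<open>V\<close> that it contributes to the cover
  of \<open>X\<close>; balls in the chart are centred at points of \<open>V\<close>, and the sets under
  consideration have to lie in \<open>U\<close>. Without this margin a plane ball close to the
  boundary of a chart may fit into the chart although no ball of larger dimension and the same
  radius around it does.
\<close>

definition chart_family ::
  "('a::topological_space, 'n::finite) chart set \<Rightarrow> ('a set \<times> ('a, 'n) chart) set \<Rightarrow> bool" where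
  "chart_family A F \<longleftrightarrow>
     finite F \<and>
     (\<forall>(V, c)\<in>F. c \<in> holomorphic_charts A \<and> open V \<and> closure V \<subseteq> fst c) \<and>
     (\<Union>(V, c)\<in>F. V) = UNIV"

definition max_norm :: "complex ^ 'n \<Rightarrow> real" where
  "max_norm u = Max (range (\<lambda>i. cmod (u $ i)))"

definition orthonormal_basis :: "('n \<Rightarrow> complex ^ 'n) \<Rightarrow> bool" where
  "orthonormal_basis e \<longleftrightarrow>
     (\<forall>i j. (\<Sum>a\<in>UNIV. e i $ a * cnj (e j $ a)) = (if i = j then 1 else 0))"

text \<open>The point with coordinates \<open>u\<close> with respect to the origin \<open>x\<close> and the basis \<open>e\<close>.\<close>

definition frame_point :: "complex ^ 'n \<Rightarrow> ('n \<Rightarrow> complex ^ 'n) \<Rightarrow> complex ^ 'n \<Rightarrow> complex ^ 'n" where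
  "frame_point x e u = x + (\<Sum>i\<in>UNIV. u $ i *s e i)"

text \<open>
  The plane \<open>P\<close> passes through \<open>x\<close> and is spanned by the \<open>e i\<close> with \<open>i \<in> S\<close>, \<open>card S = l\<close>;
  the other \<open>e i\<close> span the orthogonal complement. So \<open>S\<close> plays the role of the first \<open>l\<close>
  coordinates. Points of \<open>P\<close> and of the complement are both given by coordinate vectors
  in \<open>\<complex>\<^sup>k\<close>, supported in \<open>S\<close> and in \<open>- S\<close> respectively.
\<close>

definition plane_ball :: "'n set \<Rightarrow> real \<Rightarrow> (complex ^ 'n) set" where
  "plane_ball S r = {u. (\<forall>i. i \<notin> S \<longrightarrow> u $ i = 0) \<and> max_norm u < r}"

definition graph_map :: "'n set \<Rightarrow> real \<Rightarrow> (complex ^ 'n \<Rightarrow> complex ^ 'n) \<Rightarrow> bool" where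
  "graph_map S r \<Phi> \<longleftrightarrow>
     holomorphic_vec \<Phi> (plane_ball S r) \<and>
     (\<forall>u\<in>plane_ball S r. \<forall>i\<in>S. \<Phi> u $ i = 0) \<and>
     (\<forall>u\<in>plane_ball S r. \<forall>v\<in>plane_ball S r. max_norm (\<Phi> u - \<Phi> v) \<le> max_norm (u - v))"

text \<open>
  \<open>W\<close> is the graph of \<open>\<Phi>\<close>, with \<open>Lip(\<Phi>) \<le> 1\<close>, over a ball \<open>B\<^sub>l(x, r)\<close> in one of the charts
  of the family. For \<open>l = k\<close> one has \<open>\<Phi> = 0\<close>, so \<open>W\<close> is the ball itself.
\<close>

definition is_graph_of ::
  "('a set \<times> ('a, 'n::finite) chart) set \<Rightarrow> nat \<Rightarrow> real \<Rightarrow>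
   (complex ^ 'n \<Rightarrow> complex ^ 'n) \<Rightarrow> 'a set \<Rightarrow> bool" where
  "is_graph_of F l r \<Phi> W \<longleftrightarrow>
     (\<exists>(V, U, \<phi>)\<in>F. \<exists>x e S.
        orthonormal_basis e \<and> card S = l \<and> graph_map S r \<Phi> \<and>
        frame_point x e (\<Phi> 0) \<in> \<phi> ` V \<and>
        W \<subseteq> U \<and> \<phi> ` W = (\<lambda>u. frame_point x e (u + \<Phi> u)) ` plane_ball S r)"


section \<open>The intermediate topological entropies\<close>

definition X_orbit ::
  "('a::topological_space, 'n::finite) chart set \<Rightarrow> ('a set \<times> ('a, 'n) chart) set \<Rightarrow>
   ('a \<times> 'a) set \<Rightarrow> nat \<Rightarrow> real \<Rightarrow> nat \<Rightarrow> 'a set set" where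
  "X_orbit A F \<Gamma> l \<delta> n =
     {W. (if l = 0 then \<exists>x. W = {x} else \<exists>\<Phi>. is_graph_of F l (exp (- \<delta> * real n)) \<Phi> W) \<and>
         (\<forall>j<n. (mero_fun \<Gamma> ^^ j) ` W \<inter> indeterminacy_set A \<Gamma> = {})}"

definition X_target ::
  "('a set \<times> ('a, 'n::finite) chart) set \<Rightarrow> nat \<Rightarrow> real \<Rightarrow> 'a set set" where
  "X_target F l \<delta> =
     {W. if l = 0 then \<exists>x. W = {x} else \<exists>\<Phi>. is_graph_of F l \<delta> \<Phi> W \<and> \<Phi> 0 = 0}"

definition separated ::
  "('a::metric_space \<times> 'a) set \<Rightarrow> nat \<Rightarrow> real \<Rightarrow> 'a set set \<Rightarrow> bool" where
  "separated \<Gamma> n \<delta> E \<longleftrightarrow>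
     (\<forall>W\<in>E. \<forall>W'\<in>E. W \<noteq> W' \<longrightarrow>
        (MAX i\<in>{..<n}. setdist ((mero_fun \<Gamma> ^^ i) ` W) ((mero_fun \<Gamma> ^^ i) ` W')) \<ge> \<delta>)"

text \<open>
  The maximal cardinality is taken as a supremum over finite families in the extended
  natural numbers, and its logarithm in the extended reals, with \<open>log 0 = -\<infinity>\<close>.
\<close>

definition max_separated ::
  "('a::metric_space, 'n::finite) chart set \<Rightarrow> ('a set \<times> ('a, 'n) chart) set \<Rightarrow>
   ('a \<times> 'a) set \<Rightarrow> nat \<Rightarrow> real \<Rightarrow> nat \<Rightarrow> 'a set \<Rightarrow> enat" where
  "max_separated A F \<Gamma> l \<delta> n \<Delta> =
     (SUP E\<in>{E. finite E \<and> E \<subseteq> X_orbit A F \<Gamma> l \<delta> n \<and> separated \<Gamma> n \<delta> E \<and>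
               (\<forall>W\<in>E. (mero_fun \<Gamma> ^^ n) ` W \<subseteq> \<Delta>)}. enat (card E))"

definition log_enat :: "enat \<Rightarrow> ereal" where
  "log_enat N = (case N of enat j \<Rightarrow> if j = 0 then - \<infinity> else ereal (ln (real j)) | \<infinity> \<Rightarrow> \<infinity>)"

definition h_top ::
  "('a::metric_space, 'n::finite) chart set \<Rightarrow> ('a set \<times> ('a, 'n) chart) set \<Rightarrow>
   ('a \<times> 'a) set \<Rightarrow> nat \<Rightarrow> nat \<Rightarrow> ereal" where
  "h_top A F \<Gamma> m l =
     Limsup (at_right 0) (\<lambda>\<delta>. limsup (\<lambda>n.
       ereal (1 / real n) * log_enat (SUP \<Delta>\<in>X_target F m \<delta>. max_separated A F \<Gamma> l \<delta> n \<Delta>)))"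

end

theory Submission
  imports Defs
begin

text \<open>
  Every graph \<open>\<Delta>\<close> over an \<open>m\<close>-dimensional ball of radius \<open>\<delta>\<close> that is admitted as a target lies
  in such a graph over an \<open>(m + 1)\<close>-dimensional ball of the same radius, provided that \<open>\<delta>\<close> is
  small; all the remaining operations in the definition of the entropy are monotone, so the
  inequality follows.

  To enlarge \<open>\<Delta>\<close>, the graph of \<open>\<Phi>\<close> over the coordinates in \<open>S\<close>, choose one normal coordinate
  \<open>i\<close> and move it into the base: the new map forgets the \<open>i\<close>-th component of \<open>\<Phi>\<close> and does not
  depend on the new base variable (\<open>graph_map_insert\<close>). The point \<open>u + \<Phi> u\<close> of the old graph lies
  over \<open>u + \<Phi>\<^sub>i(u) e\<^sub>i\<close> in the new one. That this base point stays in the ball of radius \<open>\<delta>\<close> is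
  where \<open>\<Phi> 0 = 0\<close> and \<open>Lip(\<Phi>) \<le> 1\<close> enter: they give \<open>\<bar>\<Phi>\<^sub>i(u)\<bar> \<le> \<bar>u\<bar> < \<delta>\<close>
  (\<open>graph_subset_graph_insert\<close>).

  The enlarged graph must still lie in the domain \<open>U\<close> of its chart. Its points are within
  \<open>CARD('k) * \<delta>\<close> of a centre in the image of \<open>V\<close>, and the closure of \<open>V\<close> is a compact subset of
  \<open>U\<close>; so this holds once \<open>\<delta>\<close> is small, uniformly over the finitely many charts
  (\<open>eventually_frame_box_in_charts\<close>). For \<open>m = 0\<close> the target is a point, and the zero map over a
  line through that point does the job.
\<close>

section \<open>Max norm and coordinate projections\<close>

lemma max_norm_le_iff: "max_norm u \<le> r \<longleftrightarrow> (\<forall>i. cmod (u $ i) \<le> r)"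
  unfolding max_norm_def by (subst Max_le_iff) auto

lemma max_norm_less_iff: "max_norm u < r \<longleftrightarrow> (\<forall>i. cmod (u $ i) < r)"
  unfolding max_norm_def by (subst Max_less_iff) auto

lemma norm_component_le_max_norm: "cmod (u $ i) \<le> max_norm u"
  using max_norm_le_iff[of u "max_norm u"] by simp

lemma zero_in_plane_ball_iff: "0 \<in> plane_ball S r \<longleftrightarrow> 0 < r"
  by (simp add: plane_ball_def max_norm_less_iff)

definition coord_part :: "'n set \<Rightarrow> complex ^ 'n \<Rightarrow> complex ^ 'n" where
  "coord_part S u = (\<chi> i. if i \<in> S then u $ i else 0)"

lemma coord_part_nth [simp]: "coord_part S u $ i = (if i \<in> S then u $ i else 0)"
  by (simp add: coord_part_def)

lemma coord_part_zero [simp]: "coord_part S 0 = 0"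
  by (simp add: vec_eq_iff)

lemma coord_part_diff: "coord_part S u - coord_part S v = coord_part S (u - v)"
  by (simp add: vec_eq_iff)

lemma coord_part_scale: "coord_part S (c *s v) = c *s coord_part S v"
  by (simp add: vec_eq_iff)

lemma max_norm_coord_part_le: "max_norm (coord_part S u) \<le> max_norm u"
  unfolding max_norm_le_iff
  by (simp add: norm_component_le_max_norm order_trans[OF norm_ge_zero norm_component_le_max_norm])

lemma coord_part_in_plane_ball:
  assumes "u \<in> plane_ball T r"
  shows "coord_part S u \<in> plane_ball S r"
  using assms max_norm_coord_part_le[of S u] by (auto simp: plane_ball_def)

lemma bounded_linear_coord_part: "bounded_linear (coord_part S)"
proof -
  have "linear (coord_part S)"
    by (rule linearI) (auto simp: vec_eq_iff)
  then show ?thesis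
    by (rule linear_conv_bounded_linear[THEN iffD1])
qed


section \<open>Enlarging the base of a graph\<close>

lemma holomorphic_vec_coord_part:
  assumes "holomorphic_vec \<Phi> D" and sub: "coord_part S ` D' \<subseteq> D"
  shows "holomorphic_vec (\<lambda>u. coord_part T (\<Phi> (coord_part S u))) D'"
  unfolding holomorphic_vec_def holomorphic_fun_def
proof (intro allI ballI)
  fix i u assume u: "u \<in> D'"
  show "\<exists>L. ((\<lambda>v. coord_part T (\<Phi> (coord_part S v)) $ i) has_derivative L) (at u within D') \<and>
            (\<forall>c v. L (c *s v) = c * L v)"
  proof (cases "i \<in> T")
    case True
    obtain L where L: "((\<lambda>v. \<Phi> v $ i) has_derivative L) (at (coord_part S u) within D)"
        and lin: "\<And>c v. L (c *s v) = c * L v"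
      using assms u unfolding holomorphic_vec_def holomorphic_fun_def by blast
    have "((\<lambda>v. \<Phi> (coord_part S v) $ i) has_derivative (\<lambda>v. L (coord_part S v))) (at u within D')"
      by (rule has_derivative_in_compose[OF
            bounded_linear_imp_has_derivative[OF bounded_linear_coord_part]
            has_derivative_subset[OF L sub]])
    then show ?thesis
      using True lin by (intro exI[of _ "\<lambda>v. L (coord_part S v)"]) (simp add: coord_part_scale)
  next
    case False
    then show ?thesis
      by (intro exI[of _ "\<lambda>_. 0"]) simp
  qed
qed

text \<open>
  Precomposing with one coordinate projection and postcomposing with another preserves both
  requirements on \<open>\<Phi>\<close>, since the projections are complex linear and do not increase the max norm.
\<close>

lemma graph_map_insert:
  assumes "graph_map S r \<Phi>"
  shows "graph_map (insert i S) r (\<lambda>u. coord_part (- insert i S) (\<Phi> (coord_part S u)))"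
  unfolding graph_map_def
proof (intro conjI ballI)
  show "holomorphic_vec (\<lambda>u. coord_part (- insert i S) (\<Phi> (coord_part S u)))
          (plane_ball (insert i S) r)"
  proof (rule holomorphic_vec_coord_part)
    show "holomorphic_vec \<Phi> (plane_ball S r)"
      using assms by (simp add: graph_map_def)
    show "coord_part S ` plane_ball (insert i S) r \<subseteq> plane_ball S r"
      using coord_part_in_plane_ball by blast
  qed
next
  fix u v assume u: "u \<in> plane_ball (insert i S) r" and v: "v \<in> plane_ball (insert i S) r"
  have "max_norm (coord_part (- insert i S) (\<Phi> (coord_part S u)) -
                  coord_part (- insert i S) (\<Phi> (coord_part S v)))
        \<le> max_norm (\<Phi> (coord_part S u) - \<Phi> (coord_part S v))"
    unfolding coord_part_diff by (rule max_norm_coord_part_le)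
  also have "\<dots> \<le> max_norm (coord_part S u - coord_part S v)"
    using assms coord_part_in_plane_ball[OF u] coord_part_in_plane_ball[OF v]
    unfolding graph_map_def by blast
  also have "\<dots> \<le> max_norm (u - v)"
    unfolding coord_part_diff by (rule max_norm_coord_part_le)
  finally show "max_norm (coord_part (- insert i S) (\<Phi> (coord_part S u)) -
                  coord_part (- insert i S) (\<Phi> (coord_part S v))) \<le> max_norm (u - v)" .
qed simp

lemma graph_map_bound:
  assumes "graph_map S r \<Phi>" "\<Phi> 0 = 0" and u: "u \<in> plane_ball S r"
  shows "max_norm (\<Phi> u) \<le> max_norm u"
proof -
  have "0 < r"
    using u order_trans[OF norm_ge_zero norm_component_le_max_norm[of u undefined]]
    by (auto simp: plane_ball_def)
  then have "max_norm (\<Phi> u - \<Phi> 0) \<le> max_norm (u - 0)"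
    using assms(1) u zero_in_plane_ball_iff[of S r] unfolding graph_map_def by blast
  then show ?thesis
    using assms(2) by simp
qed

text \<open>
  The hypothesis \<open>\<Phi> 0 = 0\<close> cannot be dropped: otherwise the component of \<open>\<Phi>\<close> that becomes a base
  coordinate could leave the ball of radius \<open>r\<close>.
\<close>

lemma graph_subset_graph_insert:
  assumes \<Phi>: "graph_map S r \<Phi>" "\<Phi> 0 = 0" and u: "u \<in> plane_ball S r"
  obtains u' where "u' \<in> plane_ball (insert i S) r"
    "u' + coord_part (- insert i S) (\<Phi> (coord_part S u')) = u + \<Phi> u"
proof
  \<comment> \<open>If \<open>i \<in> S\<close>, then \<open>u' = u\<close>, since the components of \<open>\<Phi> u\<close> along \<open>S\<close> vanish.\<close>
  let ?u' = "u + coord_part {i} (\<Phi> u)"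
  have vanish: "\<Phi> u $ j = 0" if "j \<in> S" for j
    using \<Phi>(1) u that unfolding graph_map_def by blast
  have supp: "u $ j = 0" if "j \<notin> S" for j
    using u that by (simp add: plane_ball_def)
  have small: "cmod (u $ j) < r" "cmod (\<Phi> u $ j) < r" for j
    using graph_map_bound[OF assms] norm_component_le_max_norm[of u j]
      norm_component_le_max_norm[of "\<Phi> u" j] u
    by (auto simp: plane_ball_def)
  have "cmod (?u' $ j) < r" for j
    using small[of j] vanish[of j] supp[of j] by (cases "j \<in> S") (auto split: if_splits)
  then show "?u' \<in> plane_ball (insert i S) r"
    using supp by (simp add: plane_ball_def max_norm_less_iff)
  have base: "coord_part S ?u' = u"
    using vanish supp by (auto simp: vec_eq_iff)
  show "?u' + coord_part (- insert i S) (\<Phi> (coord_part S ?u')) = u + \<Phi> u"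
    unfolding base using vanish by (auto simp: vec_eq_iff)
qed


section \<open>Small boxes stay inside the charts\<close>

lemma norm_orthonormal_basis:
  assumes "orthonormal_basis e"
  shows "norm (e i) = 1"
proof -
  have "complex_of_real (\<Sum>a\<in>UNIV. (cmod (e i $ a))\<^sup>2) = (\<Sum>a\<in>UNIV. e i $ a * cnj (e i $ a))"
    unfolding of_real_sum by (simp only: complex_norm_square)
  also have "\<dots> = 1"
    using assms by (simp add: orthonormal_basis_def)
  finally have "(\<Sum>a\<in>UNIV. (cmod (e i $ a))\<^sup>2) = 1"
    by (metis of_real_eq_1_iff)
  then show ?thesis
    by (simp add: norm_vec_def L2_set_def)
qed

lemma norm_vector_scale: "norm (c *s v) = cmod c * norm (v :: complex ^ 'n)"
  by (simp add: norm_vec_def norm_mult L2_set_right_distrib)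

lemma dist_frame_point_le:
  fixes e :: "'n::finite \<Rightarrow> complex ^ 'n"
  assumes "orthonormal_basis e"
  shows "dist x (frame_point x e u) \<le> real CARD('n) * max_norm u"
proof -
  have "norm (\<Sum>i\<in>UNIV. u $ i *s e i) \<le> (\<Sum>i\<in>(UNIV :: 'n set). max_norm u)"
    by (rule sum_norm_le)
      (simp add: norm_vector_scale norm_orthonormal_basis[OF assms] norm_component_le_max_norm)
  then show ?thesis
    by (simp add: frame_point_def dist_norm)
qed

lemma orthonormal_basis_axis: "orthonormal_basis (\<lambda>i. axis i 1)"
proof -
  have "(\<Sum>a\<in>UNIV. axis i 1 $ a * cnj (axis j 1 $ a)) = (if i = j then 1 else (0::complex))"
    for i j :: 'a
  proof -
    have "(\<Sum>a\<in>UNIV. axis i 1 $ a * cnj (axis j 1 $ a)) =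
          (\<Sum>a\<in>UNIV. if a = i then (if i = j then 1 else (0::complex)) else 0)"
      by (rule sum.cong) (auto simp: axis_def)
    then show ?thesis by simp
  qed
  then show ?thesis
    by (simp add: orthonormal_basis_def)
qed

definition frame_box_in_chart :: "real \<Rightarrow> 'a set \<times> ('a, 'n::finite) chart \<Rightarrow> bool" where
  "frame_box_in_chart r c \<longleftrightarrow>
     (case c of (V, U, \<phi>) \<Rightarrow>
        \<forall>x\<in>\<phi> ` V. \<forall>e u. orthonormal_basis e \<longrightarrow> max_norm u < r \<longrightarrow> frame_point x e u \<in> \<phi> ` U)"

text \<open>
  The margin between \<open>V\<close> and \<open>U\<close> is what makes one radius work for all centres of a chart: the
  image of the closure of \<open>V\<close> is a compact subset of the open image of \<open>U\<close>, and so has positive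
  distance to its complement.
\<close>

lemma eventually_frame_box_in_charts:
  fixes F :: "('a::metric_space set \<times> ('a, 'n::finite) chart) set"
  assumes "compact (UNIV :: 'a set)" "chart_family A F"
  shows "eventually (\<lambda>r. \<forall>c\<in>F. frame_box_in_chart r c) (at_right 0)"
proof (rule eventually_ball_finite)
  show "finite F"
    using assms(2) by (simp add: chart_family_def)
  show "\<forall>c\<in>F. eventually (\<lambda>r. frame_box_in_chart r c) (at_right 0)"
  proof
    fix c assume "c \<in> F"
    obtain V U \<phi> where c: "c = (V, U, \<phi>)"
      by (metis prod.collapse)
    have "case c of (V, c') \<Rightarrow> c' \<in> holomorphic_charts A \<and> open V \<and> closure V \<subseteq> fst c'"
      using \<open>c \<in> F\<close> assms(2) unfolding chart_family_def by (elim conjE bspec)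
    then have chart: "topological_chart (U, \<phi>)" and sub: "closure V \<subseteq> U"
      by (simp_all add: c holomorphic_charts_def)
    have "compact (closure V)"
      using compact_Int_closed[OF assms(1) closed_closure[of V]] by simp
    then have "compact (\<phi> ` closure V)"
      using chart sub unfolding topological_chart_def
      by (auto intro!: compact_continuous_image intro: continuous_on_subset simp: homeomorphism_def)
    moreover have "open (\<phi> ` U)"
      using chart by (simp add: topological_chart_def)
    ultimately obtain \<rho> where "\<rho> > 0" and \<rho>: "(\<Union>x\<in>\<phi> ` closure V. ball x \<rho>) \<subseteq> \<phi> ` U"
      using image_mono[OF sub] by (rule compact_subset_open_imp_ball_epsilon_subset)
    have "frame_box_in_chart r c" if r: "0 < r" "r < \<rho> / real CARD('n)" for r
      unfolding frame_box_in_chart_def c prod.case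
    proof (intro ballI allI impI)
      fix x u :: "complex ^ 'n" and e :: "'n \<Rightarrow> complex ^ 'n"
      assume x: "x \<in> \<phi> ` V" and e: "orthonormal_basis e" and u: "max_norm u < r"
      have "dist x (frame_point x e u) \<le> real CARD('n) * max_norm u"
        by (rule dist_frame_point_le[OF e])
      also have "\<dots> < real CARD('n) * r"
        using u by simp
      also have "\<dots> < \<rho>"
        using r by (simp add: field_simps)
      finally have "frame_point x e u \<in> ball x \<rho>"
        by simp
      moreover have "x \<in> \<phi> ` closure V"
        using x image_mono[OF closure_subset[of V]] by (rule rev_subsetD)
      ultimately show "frame_point x e u \<in> \<phi> ` U"
        by (intro subsetD[OF \<rho>] UN_I)
    qed
    then show "eventually (\<lambda>r. frame_box_in_chart r c) (at_right 0)"
      using \<open>\<rho> > 0\<close> unfolding eventually_at_right_field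
      by (intro exI[of _ "\<rho> / real CARD('n)"]) simp
  qed
qed

text \<open>
  The members of \<open>X_target\<close> are subsets of the manifold, while graphs live in coordinates. The
  set to take is the preimage of the graph in \<open>U\<close>; it is mapped onto the graph because the graph,
  having all frame coordinates below \<open>r\<close>, does not leave the image of \<open>U\<close>.
\<close>

lemma X_target_containing_graph:
  assumes box: "frame_box_in_chart r (V, U, \<phi>)" and F: "(V, U, \<phi>) \<in> F"
    and e: "orthonormal_basis e" and S: "card S = l" "l > 0"
    and \<Phi>: "graph_map S r \<Phi>" "\<Phi> 0 = 0" and x: "x \<in> \<phi> ` V"
    and W: "W \<subseteq> U" "\<phi> ` W \<subseteq> (\<lambda>u. frame_point x e (u + \<Phi> u)) ` plane_ball S r"
  shows "\<exists>W'\<in>X_target F l r. W \<subseteq> W'"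
proof
  let ?G = "(\<lambda>u. frame_point x e (u + \<Phi> u)) ` plane_ball S r"
  let ?W = "{w \<in> U. \<phi> w \<in> ?G}"
  have "max_norm (u + \<Phi> u) < r" if u: "u \<in> plane_ball S r" for u
    unfolding max_norm_less_iff
  proof
    fix i
    have "cmod (u $ i) < r" "cmod (\<Phi> u $ i) < r"
      using graph_map_bound[OF \<Phi> u] norm_component_le_max_norm[of u i]
        norm_component_le_max_norm[of "\<Phi> u" i] u
      by (auto simp: plane_ball_def)
    \<comment> \<open>Disjoint supports are what gives the bound \<open>r\<close> instead of \<open>2 * r\<close>.\<close>
    moreover have "u $ i = 0 \<or> \<Phi> u $ i = 0"
      using \<Phi>(1) u unfolding graph_map_def plane_ball_def by blast
    ultimately show "cmod ((u + \<Phi> u) $ i) < r"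
      by auto
  qed
  then have sub: "?G \<subseteq> \<phi> ` U"
    using box e x unfolding frame_box_in_chart_def by auto
  have "\<phi> ` ?W = ?G"
  proof
    show "?G \<subseteq> \<phi> ` ?W"
    proof
      fix q assume q: "q \<in> ?G"
      then obtain w where "w \<in> U" "q = \<phi> w"
        using subsetD[OF sub q] by (elim imageE)
      with q show "q \<in> \<phi> ` ?W"
        by (intro image_eqI[of _ _ w]) simp_all
    qed
  qed (simp add: image_subset_iff)
  moreover have "frame_point x e (\<Phi> 0) \<in> \<phi> ` V"
    using x \<Phi>(2) by (simp add: frame_point_def)
  moreover have "?W \<subseteq> U"
    by blast
  ultimately have "is_graph_of F l r \<Phi> ?W"
    using F e S(1) \<Phi>(1) unfolding is_graph_of_def
    by (intro bexI[of _ "(V, U, \<phi>)"]) auto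
  then show "?W \<in> X_target F l r"
    using S(2) \<Phi>(2) by (auto simp: X_target_def)
  show "W \<subseteq> ?W"
    using W by blast
qed

lemma X_target_Suc:
  fixes F :: "('a::topological_space set \<times> ('a, 'n::finite) chart) set"
  assumes box: "\<forall>c\<in>F. frame_box_in_chart r c" and r: "0 < r"
    and F: "chart_family A F" and m: "m < CARD('n)"
    and W: "W \<in> X_target F m r"
  shows "\<exists>W'\<in>X_target F (Suc m) r. W \<subseteq> W'"
proof (cases "m = 0")
  case True
  then obtain p where p: "W = {p}"
    using W by (auto simp: X_target_def)
  have "p \<in> (\<Union>(V, c)\<in>F. V)"
    using F by (simp add: chart_family_def)
  then obtain V U \<phi> where VU: "(V, U, \<phi>) \<in> F" "p \<in> V"
    by auto
  then have "p \<in> U"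
    using F closure_subset[of V] unfolding chart_family_def by fastforce
  \<comment> \<open>Any coordinate line through the point will do.\<close>
  define S :: "'n set" where "S = {undefined}"
  have graph: "graph_map S r (\<lambda>_. 0)"
    unfolding graph_map_def holomorphic_vec_def holomorphic_fun_def
  proof (intro conjI allI ballI)
    fix u v :: "complex ^ 'n"
    show "max_norm (0 - 0 :: complex ^ 'n) \<le> max_norm (u - v)"
      unfolding max_norm_le_iff
      by (simp add: order_trans[OF norm_ge_zero norm_component_le_max_norm])
  qed (auto intro: exI[of _ "\<lambda>_. 0"])
  have "\<phi> p = frame_point (\<phi> p) (\<lambda>i. axis i 1) (0 + 0)"
    by (simp add: frame_point_def)
  then have img: "\<phi> ` W \<subseteq> (\<lambda>u. frame_point (\<phi> p) (\<lambda>i. axis i 1) (u + 0)) ` plane_ball S r"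
    using image_eqI[of "\<phi> p" _ 0 "plane_ball S r"] zero_in_plane_ball_iff[of S r] r p by simp
  show ?thesis
    by (rule X_target_containing_graph[OF _ VU(1) orthonormal_basis_axis _ _ graph _ _ _ img])
      (use VU \<open>p \<in> U\<close> box True p in \<open>simp_all add: S_def\<close>)
next
  case False
  then obtain \<Phi> where "is_graph_of F m r \<Phi> W" and \<Phi>0: "\<Phi> 0 = 0"
    using W by (auto simp: X_target_def)
  then obtain V U \<phi> x e S where VU: "(V, U, \<phi>) \<in> F" and e: "orthonormal_basis e"
    and S: "card S = m" and \<Phi>: "graph_map S r \<Phi>"
    and x: "frame_point x e (\<Phi> 0) \<in> \<phi> ` V" and WU: "W \<subseteq> U"
    and img: "\<phi> ` W = (\<lambda>u. frame_point x e (u + \<Phi> u)) ` plane_ball S r"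
    unfolding is_graph_of_def Bex_def split_paired_Ex prod.case by (elim exE conjE) (rule that)
  obtain i where i: "i \<notin> S"
    using S m by (metis UNIV_I card_mono finite not_less subsetI)
  let ?\<Psi> = "\<lambda>u. coord_part (- insert i S) (\<Phi> (coord_part S u))"
  show ?thesis
  proof (rule X_target_containing_graph[OF _ VU e _ _ graph_map_insert[OF \<Phi>, of i]])
    show "\<phi> ` W \<subseteq> (\<lambda>u. frame_point x e (u + ?\<Psi> u)) ` plane_ball (insert i S) r"
    proof
      fix q assume "q \<in> \<phi> ` W"
      then obtain u where u: "u \<in> plane_ball S r" "q = frame_point x e (u + \<Phi> u)"
        unfolding img by blast
      obtain u' where "u' \<in> plane_ball (insert i S) r" "u' + ?\<Psi> u' = u + \<Phi> u"
        using graph_subset_graph_insert[OF \<Phi> \<Phi>0 u(1), of i] by blast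
      then show "q \<in> (\<lambda>u. frame_point x e (u + ?\<Psi> u)) ` plane_ball (insert i S) r"
        using u(2) by (metis (no_types, lifting) image_eqI)
    qed
    show "x \<in> \<phi> ` V"
      using x \<Phi>0 by (simp add: frame_point_def)
    show "frame_box_in_chart r (V, U, \<phi>)"
      using box VU by (rule bspec)
    show "card (insert i S) = Suc m"
      using S i by simp
  qed (simp_all add: WU \<Phi>0)
qed


section \<open>Monotonicity of the entropy\<close>

lemma max_separated_mono:
  assumes "\<Delta> \<subseteq> \<Delta>'"
  shows "max_separated A F \<Gamma> l \<delta> n \<Delta> \<le> max_separated A F \<Gamma> l \<delta> n \<Delta>'"
  unfolding max_separated_def
  using assms by (intro SUP_subset_mono Collect_mono impI order_refl) (meson subset_trans)

lemma log_enat_mono: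
  assumes "M \<le> N"
  shows "log_enat M \<le> log_enat N"
  using assms by (cases M; cases N) (auto simp: log_enat_def)

theorem proposition0p3:
  fixes A :: "('a::metric_space, 'k::finite) chart set"
    and F :: "('a set \<times> ('a, 'k) chart) set"
    and f :: "('a \<times> 'a) set"
    and m l :: nat
  assumes "compact_complex_manifold A"
    and "chart_family A F"
    and "meromorphic_map A f"
    and "dominating f"
    and "m \<le> CARD('k) - 1"
    and "l \<le> m"
  shows "h_top A F f (m + 1) l \<ge> h_top A F f m l"
proof -
  have m: "m < CARD('k)"
    using assms(5) zero_less_card_finite[where 'a = 'k] by linarith
  have "compact (UNIV :: 'a set)"
    using assms(1) by (simp add: compact_complex_manifold_def)
  then have "eventually (\<lambda>\<delta>. \<forall>c\<in>F. frame_box_in_chart \<delta> c) (at_right 0)"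
    using assms(2) by (rule eventually_frame_box_in_charts)
  moreover have "eventually (\<lambda>\<delta>::real. \<delta> > 0) (at_right 0)"
    by (rule eventually_at_right_less)
  ultimately have "eventually (\<lambda>\<delta>. \<forall>W\<in>X_target F m \<delta>. \<exists>W'\<in>X_target F (m + 1) \<delta>. W \<subseteq> W') (at_right 0)"
    by eventually_elim (use X_target_Suc[OF _ _ assms(2) m] in auto)
  then have "eventually (\<lambda>\<delta>.
      limsup (\<lambda>n. ereal (1 / real n) *
        log_enat (SUP \<Delta>\<in>X_target F m \<delta>. max_separated A F f l \<delta> n \<Delta>)) \<le>
      limsup (\<lambda>n. ereal (1 / real n) *
        log_enat (SUP \<Delta>\<in>X_target F (m + 1) \<delta>. max_separated A F f l \<delta> n \<Delta>))) (at_right 0)"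
  proof eventually_elim
    case (elim \<delta>)
    have "(SUP \<Delta>\<in>X_target F m \<delta>. max_separated A F f l \<delta> n \<Delta>) \<le>
          (SUP \<Delta>\<in>X_target F (m + 1) \<delta>. max_separated A F f l \<delta> n \<Delta>)" for n
      using elim by (intro SUP_mono) (meson max_separated_mono)
    then show ?case
      by (intro Limsup_mono always_eventually allI ereal_mult_left_mono log_enat_mono) simp_all
  qed
  then show ?thesis
    unfolding h_top_def by (rule Limsup_mono)
qed

end
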